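(* Let $1\le m\le n$. A poset $P$ is isomorphic to the face poset of an $m$-dimensional local tropical linear space in $\mathbb{R}^n$ if and only if $P$ is isomorphic to the dual (i.e. order-reversed) face poset of a coherent mixed subdivision of a Minkowski sum of simplices $\sum_{j=1}^{n-m}\Delta_{I_j}\subseteq\mathbb{R}^m$, where $I_j\subseteq[m]$ is a nonempty subset for all $j$.
   Context: Notation: $[n]=\{1,\dots,n\}$; $\binom{[n]}{m}$ is the set of $m$-element subsets of $[n]$; $\mathbb{T}=\mathbb{R}\cup\{\infty\}$; $S\cup i$, $S-i$ mean $S\cup\{i\}$, $S\setminus\{i\}$. Tropical Plücker vector of rank $m$: a vector $p\in\mathbb{T}^{\binom{[n]}{m}}$, not identically $\infty$, such that for all $S,T\subseteq[n]$ with $|S|=m-1$, $|T|=m+1$, the minimum $\min_{i\in T\setminus S}(p_{S\cup i}+p_{T-i})$ is achieved for at least two values of $i$ or equals $\infty$. Its support $\{A:p_A\ne\infty\}$ is the set of bases of a matroid $M$ on $[n]$, the underlying matroid of $p$. For $S\subseteq[n]$ with $|S|=m+1$ let $c_S\in\mathbb{T}^n$ be given by $(c_S)_i=p_{S-i}$ if $i\in S$, $\infty$ otherwise. The circuits of $p$ are the vectors $c_S+\lambda(1,\dots,1)$, $\lambda\in\mathbb{R}$, with $c_S\ne(\infty,\dots,\infty)$. Vectors $x,y\in\mathbb{T}^n$ are tropically orthogonal if $\min_i(x_i+y_i)$ is achieved at least twice or equals $\infty$. $L(p)\subseteq\mathbb{T}^n$ is the set of vectors tropically orthogonal to all circuits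 of $p$. For a basis $A$ of $M$ and $v\in\mathbb{R}^n$, let $w_p(v,A)=-p_A+\sum_{i\in A}v_i$. The bases of $M$ maximizing $w_p(v,\cdot)$ are the bases of a matroid $M_v$. For a basis $B$ of $M$, $\Sigma_B=\{v\in\mathbb{R}^n: B\text{ is a basis of }M_v\}$ and $L(p)_B=L(p)\cap\Sigma_B$. An $m$-dimensional local tropical linear space in $\mathbb{R}^n$ is a set $L(p)_B$ with $p\in\mathbb{T}^{\binom{[n]}{m}}$ a tropical Plücker vector of rank $m$ whose underlying matroid $M$ has no loops, and $B$ a basis of $M$. It is a polyhedral complex whose cells are the closures of the sets $\{v'\in L(p)_B: M_{v'}=M_v\}$, $v\in L(p)_B$; its face poset is the set of these cells ordered by inclusion. For nonempty $I\subseteq[m]$, $\Delta_I=\mathrm{conv}\{e_i:i\in I\}\subseteq\mathbb{R}^m$. A coherent (regular) mixed subdivision of $\sum_{j=1}^{s}\Delta_{I_j}$ is a mixed subdivision corresponding under the Cayley trick to a regular subdivision of the Cayley embedding $\mathrm{conv}\bigcup_j(e_j\times\Delta_{I_j})\subseteq\mathbb{R}^s\times\mathbb{R}^m$. Explicitly, it is given by real heights $h_{ij}$ ($1\le j\le s$, $i\in I_j$), and its nonempty faces are the polytopes $\sum_{j=1}^s\Delta_{F_j(u)}$ for $u\in\mathbb{R}^m$, where $F_j(u)\subseteq I_j$ is the set of $i\in I_j$ minimizing $h_{ij}-u_i$. Its face poset is the set of nonempty faces (of all dimensions, including those on the boundary) ordered by inclusion. If $s=0$ the Minkowski sum is the point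 $\{0\}$ with its unique subdivision. *)

theory Defs
  imports "HOL-Analysis.Analysis"
begin

text \<open>
  The ground set \<open>[n]\<close> is a finite type \<open>'n\<close> with \<open>n = CARD('n)\<close>, and \<open>[m]\<close> is a finite
  type \<open>'m\<close> with \<open>m = CARD('m)\<close>; the rank enters as a natural number \<open>m\<close>.  The tropical
  numbers \<open>\<real> \<union> {\<infinity>}\<close> are the elements of \<^typ>\<open>ereal\<close> other than \<open>-\<infinity>\<close>.
\<close>

definition min_twice :: "('i \<Rightarrow> ereal) \<Rightarrow> 'i set \<Rightarrow> bool" where
  "min_twice f J \<longleftrightarrow>
     (MIN i\<in>J. f i) = \<infinity> \<or>
     (\<exists>i\<in>J. \<exists>k\<in>J. i \<noteq> k \<and> f i = (MIN l\<in>J. f l) \<and> f k = (MIN l\<in>J. f l))"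

text \<open>
  A vector with coordinates indexed by the \<open>m\<close>-element subsets is a function on all subsets of
  which only the values at \<open>m\<close>-element sets are ever used.
\<close>

definition bases :: "nat \<Rightarrow> ('n::finite set \<Rightarrow> ereal) \<Rightarrow> 'n set set" where
  "bases m p = {A. card A = m \<and> p A \<noteq> \<infinity>}"

definition tropical_pluecker :: "nat \<Rightarrow> ('n::finite set \<Rightarrow> ereal) \<Rightarrow> bool" where
  "tropical_pluecker m p \<longleftrightarrow>
     (\<forall>A. card A = m \<longrightarrow> p A \<noteq> -\<infinity>) \<and>
     (\<exists>A. card A = m \<and> p A \<noteq> \<infinity>) \<and>
     (\<forall>S T. card S = m - 1 \<and> card T = m + 1 \<longrightarrow>
        min_twice (\<lambda>i. p (S \<union> {i}) + p (T - {i})) (T - S))"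

text \<open>A matroid is given by its set of bases; a loop is an element contained in no basis.\<close>

definition loopless :: "'n set set \<Rightarrow> bool" where
  "loopless \<B> \<longleftrightarrow> (\<forall>i. \<exists>A\<in>\<B>. i \<in> A)"

definition circuit_vec :: "('n::finite set \<Rightarrow> ereal) \<Rightarrow> 'n set \<Rightarrow> ereal ^ 'n" where
  "circuit_vec p S = (\<chi> i. if i \<in> S then p (S - {i}) else \<infinity>)"

definition circuits :: "nat \<Rightarrow> ('n::finite set \<Rightarrow> ereal) \<Rightarrow> (ereal ^ 'n) set" where
  "circuits m p =
     {(\<chi> i. circuit_vec p S $ i + ereal t) | S t.
        card S = m + 1 \<and> circuit_vec p S \<noteq> (\<chi> i. \<infinity>)}"

definition trop_orthogonal :: "ereal ^ 'n \<Rightarrow> ereal ^ 'n \<Rightarrow> bool" where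
  "trop_orthogonal x y \<longleftrightarrow> min_twice (\<lambda>i. x $ i + y $ i) UNIV"

definition trop_linear_space :: "nat \<Rightarrow> ('n::finite set \<Rightarrow> ereal) \<Rightarrow> (ereal ^ 'n) set" where
  "trop_linear_space m p =
     {x. (\<forall>i. x $ i \<noteq> -\<infinity>) \<and> (\<forall>c\<in>circuits m p. trop_orthogonal x c)}"

definition weight :: "('n::finite set \<Rightarrow> ereal) \<Rightarrow> real ^ 'n \<Rightarrow> 'n set \<Rightarrow> ereal" where
  "weight p v A = - p A + ereal (\<Sum>i\<in>A. v $ i)"

definition initial_bases :: "nat \<Rightarrow> ('n::finite set \<Rightarrow> ereal) \<Rightarrow> real ^ 'n \<Rightarrow> 'n set set" where
  "initial_bases m p v =
     {A \<in> bases m p. \<forall>A'\<in>bases m p. weight p v A' \<le> weight p v A}"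

definition local_trop_linear_space ::
    "nat \<Rightarrow> ('n::finite set \<Rightarrow> ereal) \<Rightarrow> 'n set \<Rightarrow> (real ^ 'n) set" where
  "local_trop_linear_space m p B =
     {v. (\<chi> i. ereal (v $ i)) \<in> trop_linear_space m p \<and> B \<in> initial_bases m p v}"

definition local_cells ::
    "nat \<Rightarrow> ('n::finite set \<Rightarrow> ereal) \<Rightarrow> 'n set \<Rightarrow> (real ^ 'n) set set" where
  "local_cells m p B =
     (\<lambda>v. closure {v' \<in> local_trop_linear_space m p B.
                     initial_bases m p v' = initial_bases m p v})
       ` local_trop_linear_space m p B"

definition simplex_face :: "'m::finite set \<Rightarrow> (real ^ 'm) set" where
  "simplex_face I = convex hull ((\<lambda>i. axis i 1) ` I)"

text \<open>
  The coherent mixed subdivision of \<open>\<Sum>j\<in>J. simplex_face (I j)\<close> with heights \<open>h j i\<close>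
  (only the values with \<open>i \<in> I j\<close> matter).  Through the Cayley trick these are heights on the
  vertices \<open>(e\<^sub>j, e\<^sub>i)\<close> of the Cayley embedding; the linear functional \<open>u\<close> selects from each
  summand the vertices lying on the lower face it supports.  Sums of sets are Minkowski sums,
  and the empty sum is \<open>{0}\<close>.
\<close>

definition min_vertices :: "('m \<Rightarrow> real) \<Rightarrow> 'm set \<Rightarrow> real ^ 'm::finite \<Rightarrow> 'm set" where
  "min_vertices h I u = {i \<in> I. \<forall>k\<in>I. h i - u $ i \<le> h k - u $ k}"

definition mixed_subdivision_faces ::
    "'j set \<Rightarrow> ('j \<Rightarrow> 'm::finite set) \<Rightarrow> ('j \<Rightarrow> 'm \<Rightarrow> real) \<Rightarrow> (real ^ 'm) set set" where
  "mixed_subdivision_faces J I h =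
     range (\<lambda>u. \<Sum>j\<in>J. simplex_face (min_vertices (h j) (I j) u))"

definition face_poset :: "'a set set \<Rightarrow> 'a set rel" where
  "face_poset \<F> = relation_of (\<subseteq>) \<F>"

text \<open>Reflexive orders are relations whose carrier is their field.\<close>

definition poset_iso :: "'a rel \<Rightarrow> 'b rel \<Rightarrow> bool" where
  "poset_iso r s \<longleftrightarrow>
     (\<exists>f. bij_betw f (Field r) (Field s) \<and>
          (\<forall>x\<in>Field r. \<forall>y\<in>Field r. (x, y) \<in> r \<longleftrightarrow> (f x, f y) \<in> s))"

end

theory Submission
  imports Defs
begin

text \<open>
  Fix a basis \<open>B\<close> of the valuated matroid \<open>p\<close> and put \<open>h i b = p (B - b \<union> i) - p B\<close> for
  \<open>i \<notin> B\<close> and \<open>b \<in> B\<close>.  A point \<open>v\<close> with \<open>B\<close> among its initial bases lies in the tropical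
  linear space iff its initial matroid has no loops
  (\<open>in_linear_space_iff_loopless_at\<close>), and a local maximum of the weight over bases is a global
  one (\<open>initial_basis_iff_local\<close>).  Together this says that the local tropical linear space
  is the graph

    \<open>v i = min {h i b + v b | b \<in> B}\<close> for all \<open>i \<notin> B\<close>,

  so it is parametrized by the free coordinates \<open>v b\<close> (\<open>local_space_iff_graph\<close> and
  \<open>chart_onto\<close>).  With \<open>u b = - v b\<close>, the minimizing \<open>b\<close> are the vertices of the face that
  \<open>u\<close> selects from the \<open>i\<close>-th summand, the simplex on those \<open>b\<close> for which \<open>h i b\<close> is finite, in
  the mixed subdivision with heights \<open>h\<close>.  It remains to see that on both sides the face poset is the set of tuples of minimizers,
  ordered by inclusion or reverse inclusion.

  For the linear space, the tuple determines the neighbours of \<open>B\<close> among the initial bases, and these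
  determine all initial bases by the symmetric exchange property (\<open>initial_bases_subset_iff\<close>).
  Closures of strata can be described by segments between points of the graph
  (\<open>cell_subset_iff\<close>).  For the mixed subdivision, a cell determines its summands because
  a decomposition of a point that comes from one cell has least height, and is therefore optimal for
  every other cell containing the point (\<open>mixed_face_subset_iff\<close>).

  This proves the equivalence once every choice of supports and heights arises from some \<open>p\<close>.
  Such a \<open>p\<close> is given by the tropical maximal minors of the matrix which consists of a tropical
  identity matrix and the given heights (\<open>trop_minor_stiefel\<close>).  Its Pluecker relations
  follow from interchanging two optimal matchings along an alternating path
  (\<open>matching_exchange\<close>).
\<close>

section \<open>Faces of coherent mixed subdivisions\<close>

text \<open>
  The ordinary coordinates are barycentric coordinates of the standard simplex, so that lying
  on a face becomes a condition on signs and support.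
\<close>

lemma simplex_face_iff:
  fixes x :: "real ^ 'm::finite"
  shows "x \<in> simplex_face I \<longleftrightarrow>
    (\<forall>i. 0 \<le> x $ i) \<and> (\<forall>i. i \<notin> I \<longrightarrow> x $ i = 0) \<and> (\<Sum>i\<in>UNIV. x $ i) = 1"
proof
  have inj: "inj_on (\<lambda>i. axis i (1::real) :: real ^ 'm) I"
    by (auto simp: inj_on_def axis_eq_axis)
  have coord: "(\<Sum>k\<in>I. u k *\<^sub>R (axis k (1::real) :: real ^ 'm)) $ i = (if i \<in> I then u i else 0)"
    for u :: "'m \<Rightarrow> real" and i
    by (simp add: axis_def if_distrib [of "\<lambda>z. _ * z"] cong: if_cong)
  {
    assume "x \<in> simplex_face I"
    then obtain w where w: "\<forall>y\<in>(\<lambda>i. axis i 1) ` I. 0 \<le> w y" "sum w ((\<lambda>i. axis i 1) ` I) = 1"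
        "x = (\<Sum>y\<in>(\<lambda>i. axis i 1) ` I. w y *\<^sub>R y)"
      unfolding simplex_face_def by (subst (asm) convex_hull_finite) auto
    define u where "u i = w (axis i 1)" for i
    have x: "x $ i = (if i \<in> I then u i else 0)" for i
      using w(3) coord[of u i] by (simp add: sum.reindex[OF inj] u_def)
    have "(\<Sum>i\<in>UNIV. x $ i) = sum u I"
      by (simp add: x sum.If_cases)
    then show "(\<forall>i. 0 \<le> x $ i) \<and> (\<forall>i. i \<notin> I \<longrightarrow> x $ i = 0) \<and> (\<Sum>i\<in>UNIV. x $ i) = 1"
      using w(1,2) x by (simp add: u_def sum.reindex[OF inj])
  next
    assume r: "(\<forall>i. 0 \<le> x $ i) \<and> (\<forall>i. i \<notin> I \<longrightarrow> x $ i = 0) \<and> (\<Sum>i\<in>UNIV. x $ i) = 1"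
    have "(\<Sum>i\<in>I. x $ i) = (\<Sum>i\<in>UNIV. x $ i)"
      by (rule sum.mono_neutral_left) (use r in auto)
    moreover have "x = (\<Sum>i\<in>I. (x $ i) *\<^sub>R axis i 1)"
      unfolding vec_eq_iff coord using r by auto
    moreover have "(\<Sum>i\<in>I. (x $ i) *\<^sub>R axis i 1) \<in> simplex_face I"
      unfolding simplex_face_def
      by (rule convex_sum) (use r calculation(1) in \<open>auto intro: hull_inc\<close>)
    ultimately show "x \<in> simplex_face I" by simp
  }
qed

lemma min_vertices_nonempty:
  fixes u :: "real ^ 'm::finite"
  assumes "I \<noteq> {}"
  shows "min_vertices h I u \<noteq> {}"
  using ex_min_if_finite[of "(\<lambda>i. h i - u $ i) ` I"] assms
  unfolding min_vertices_def by (fastforce simp: not_less)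

text \<open>
  The height of a point of a simplex is read off from its barycentric coordinates, and \<open>u\<close> is
  subtracted as a linear functional.  Because of this splitting, the part depending on \<open>u\<close>
  sees only the sum when the tilted heights of several points are added.
\<close>

definition tilted_height :: "('m \<Rightarrow> real) \<Rightarrow> real ^ 'm::finite \<Rightarrow> real ^ 'm \<Rightarrow> real" where
  "tilted_height h u x = (\<Sum>i\<in>UNIV. h i * x $ i) - u \<bullet> x"

lemma tilted_height_alt: "tilted_height h u x = (\<Sum>i\<in>UNIV. (h i - u $ i) * x $ i)"
  by (simp add: tilted_height_def inner_vec_def sum_subtractf algebra_simps)

text \<open>
  A linear function on a simplex is minimal exactly on the face spanned by the vertices where it is
  minimal.  This turns membership in a cell of the subdivision into an optimization statement.
\<close>

lemma simplex_face_min_vertices: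
  fixes u :: "real ^ 'm::finite"
  assumes "I \<noteq> {}"
  shows "simplex_face (min_vertices h I u) =
    {x \<in> simplex_face I. \<forall>y\<in>simplex_face I. tilted_height h u x \<le> tilted_height h u y}"
proof -
  obtain k where k: "k \<in> min_vertices h I u"
    using min_vertices_nonempty[OF assms] by blast
  define \<mu> where "\<mu> = h k - u $ k"
  have k_min: "k \<in> I" "\<And>i. i \<in> I \<Longrightarrow> \<mu> \<le> h i - u $ i"
    using k by (auto simp: min_vertices_def \<mu>_def)
  have in_min: "i \<in> min_vertices h I u \<longleftrightarrow> i \<in> I \<and> h i - u $ i = \<mu>" for i
    using k by (auto simp: min_vertices_def \<mu>_def intro: antisym)
  have excess: "tilted_height h u x - \<mu> = (\<Sum>i\<in>UNIV. (h i - u $ i - \<mu>) * x $ i)"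
    if "x \<in> simplex_face I" for x
  proof -
    have "(\<Sum>i\<in>UNIV. \<mu> * x $ i) = \<mu>"
      using that by (simp add: simplex_face_iff flip: sum_distrib_left)
    then show ?thesis
      by (simp add: tilted_height_alt left_diff_distrib sum_subtractf)
  qed
  have nonneg: "0 \<le> (h i - u $ i - \<mu>) * x $ i" if "x \<in> simplex_face I" for x i
    using that k_min(2)[of i] by (cases "i \<in> I") (auto simp: simplex_face_iff)
  have lower: "\<mu> \<le> tilted_height h u x" if "x \<in> simplex_face I" for x
    using excess[OF that] sum_nonneg[of UNIV "\<lambda>i. (h i - u $ i - \<mu>) * x $ i"] nonneg[OF that]
    by simp
  have attained: "tilted_height h u x = \<mu> \<longleftrightarrow> x \<in> simplex_face (min_vertices h I u)"
    if x: "x \<in> simplex_face I" for x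
  proof -
    have "tilted_height h u x = \<mu> \<longleftrightarrow> (\<forall>i. (h i - u $ i - \<mu>) * x $ i = 0)"
      using excess[OF x] sum_nonneg_eq_0_iff[of UNIV "\<lambda>i. (h i - u $ i - \<mu>) * x $ i"] nonneg[OF x]
      by auto
    also have "\<dots> \<longleftrightarrow> x \<in> simplex_face (min_vertices h I u)"
      using x by (auto simp: simplex_face_iff in_min)
    finally show ?thesis .
  qed
  have sub: "simplex_face (min_vertices h I u) \<subseteq> simplex_face I"
    unfolding simplex_face_def by (intro hull_mono image_mono) (auto simp: min_vertices_def)
  have "axis k 1 \<in> simplex_face (min_vertices h I u)"
    using k by (auto simp: simplex_face_def intro: hull_inc)
  then have "tilted_height h u (axis k 1) = \<mu>" "axis k 1 \<in> simplex_face I"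
    using attained sub by auto
  then show ?thesis
    using sub attained lower by (auto intro: antisym) (metis order_antisym)
qed

lemma simplex_face_full_support:
  fixes F :: "'m::finite set"
  assumes "F \<noteq> {}"
  obtains x where "x \<in> simplex_face F" "\<And>i. i \<in> F \<Longrightarrow> x $ i \<noteq> 0"
proof
  let ?x = "\<chi> i. if i \<in> F then 1 / real (card F) else 0"
  show "?x \<in> simplex_face F"
    using assms by (simp add: simplex_face_iff sum.If_cases)
  show "?x $ i \<noteq> 0" if "i \<in> F" for i
    using that by auto
qed

text \<open>
  A Minkowski cell determines its summands.  Take a point \<open>x\<close> which is a sum of relative
  interior points of the summands belonging to \<open>u\<close>, and decompose it again with respect to \<open>u'\<close>.
  Both decompositions of \<open>x\<close> have the least total height among all decompositions, so the first
  one is optimal for \<open>u'\<close> as well, and its summands already lie in the faces belonging to \<open>u'\<close>.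
\<close>

lemma mixed_face_subset_iff:
  fixes I :: "'j \<Rightarrow> 'm::finite set" and u u' :: "real ^ 'm"
  assumes fin: "finite J" and I: "\<And>j. j \<in> J \<Longrightarrow> I j \<noteq> {}"
  shows "(\<Sum>j\<in>J. simplex_face (min_vertices (h j) (I j) u))
           \<subseteq> (\<Sum>j\<in>J. simplex_face (min_vertices (h j) (I j) u'))
     \<longleftrightarrow> (\<forall>j\<in>J. min_vertices (h j) (I j) u \<subseteq> min_vertices (h j) (I j) u')"
    (is "(\<Sum>j\<in>J. simplex_face (?F j)) \<subseteq> (\<Sum>j\<in>J. simplex_face (?F' j)) \<longleftrightarrow> _")
proof
  assume "\<forall>j\<in>J. ?F j \<subseteq> ?F' j"
  then have "simplex_face (?F j) \<subseteq> simplex_face (?F' j)" if "j \<in> J" for j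
    unfolding simplex_face_def using that by (intro hull_mono image_mono) auto
  then show "(\<Sum>j\<in>J. simplex_face (?F j)) \<subseteq> (\<Sum>j\<in>J. simplex_face (?F' j))"
    unfolding set_sum_alt[OF fin] by blast
next
  assume sub: "(\<Sum>j\<in>J. simplex_face (?F j)) \<subseteq> (\<Sum>j\<in>J. simplex_face (?F' j))"
  have "\<exists>x. x \<in> simplex_face (?F j) \<and> (\<forall>i\<in>?F j. x $ i \<noteq> 0)" if "j \<in> J" for j
    using simplex_face_full_support[OF min_vertices_nonempty[OF I[OF that]]] by metis
  then obtain x where x: "\<And>j. j \<in> J \<Longrightarrow> x j \<in> simplex_face (?F j)"
      and x_supp: "\<And>j i. j \<in> J \<Longrightarrow> i \<in> ?F j \<Longrightarrow> x j $ i \<noteq> 0"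
    by metis
  have "sum x J \<in> (\<Sum>j\<in>J. simplex_face (?F' j))"
    using sub x unfolding set_sum_alt[OF fin] by blast
  then obtain y where y: "\<And>j. j \<in> J \<Longrightarrow> y j \<in> simplex_face (?F' j)" and xy: "sum x J = sum y J"
    unfolding set_sum_alt[OF fin] by auto
  let ?t = "\<lambda>u j. tilted_height (h j) u"
  have xI: "x j \<in> simplex_face (I j)"
    and le: "?t u j (x j) \<le> ?t u j (y j)" and ge: "?t u' j (y j) \<le> ?t u' j (x j)"
    if "j \<in> J" for j
    using x[OF that] y[OF that] unfolding simplex_face_min_vertices[OF I[OF that]] by auto
  \<comment> \<open>The linear parts of the two tilts agree on equal sums, so minimality with respect to
     \<open>u\<close> and to \<open>u'\<close> compares the same two total heights in opposite directions.\<close>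
  have tilt: "(\<Sum>j\<in>J. ?t w j (x j)) - (\<Sum>j\<in>J. ?t w j (y j)) =
      (\<Sum>j\<in>J. \<Sum>i\<in>UNIV. h j i * x j $ i) - (\<Sum>j\<in>J. \<Sum>i\<in>UNIV. h j i * y j $ i)" for w
    using xy by (simp add: tilted_height_def sum_subtractf flip: inner_sum_right)
  have "(\<Sum>j\<in>J. ?t u j (x j)) \<le> (\<Sum>j\<in>J. ?t u j (y j))"
    by (rule sum_mono) (rule le)
  then have "(\<Sum>j\<in>J. ?t u' j (x j)) \<le> (\<Sum>j\<in>J. ?t u' j (y j))"
    using tilt[of u] tilt[of u'] by linarith
  then have "(\<Sum>j\<in>J. ?t u' j (x j) - ?t u' j (y j)) \<le> 0"
    by (simp add: sum_subtractf)
  moreover have pos: "0 \<le> ?t u' j (x j) - ?t u' j (y j)" if "j \<in> J" for j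
    using ge[OF that] by simp
  ultimately have "(\<Sum>j\<in>J. ?t u' j (x j) - ?t u' j (y j)) = 0"
    by (intro antisym sum_nonneg) auto
  then have eq: "?t u' j (x j) = ?t u' j (y j)" if "j \<in> J" for j
    using sum_nonneg_eq_0_iff[OF fin, of "\<lambda>j. ?t u' j (x j) - ?t u' j (y j)"] pos that by auto
  have "x j \<in> simplex_face (?F' j)" if "j \<in> J" for j
    using y[OF that] xI[OF that] eq[OF that]
    unfolding simplex_face_min_vertices[OF I[OF that]] by auto
  then show "\<forall>j\<in>J. ?F j \<subseteq> ?F' j"
    using x_supp by (auto simp: simplex_face_iff) blast
qed

section \<open>Exchange for valuated matroids\<close>

text \<open>
  In this form the minimum itself disappears, and the condition can be applied at an index of
  one's choice: no finite entry is strictly smaller than all others.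
\<close>

lemma min_twice_iff:
  assumes "finite J" "J \<noteq> {}"
  shows "min_twice f J \<longleftrightarrow> (\<forall>i\<in>J. f i \<noteq> \<infinity> \<longrightarrow> (\<exists>k\<in>J. k \<noteq> i \<and> f k \<le> f i))"
proof -
  let ?\<mu> = "MIN i\<in>J. f i"
  have le: "?\<mu> \<le> f i" if "i \<in> J" for i
    using assms that by simp
  have "?\<mu> \<in> f ` J"
    using assms by (intro Min_in) auto
  then obtain a where a: "a \<in> J" "f a = ?\<mu>"
    by (metis imageE)
  show ?thesis
  proof
    assume "min_twice f J"
    then consider "?\<mu> = \<infinity>" | b c where "b \<in> J" "c \<in> J" "b \<noteq> c" "f b = ?\<mu>" "f c = ?\<mu>"
      unfolding min_twice_def by blast
    then show "\<forall>i\<in>J. f i \<noteq> \<infinity> \<longrightarrow> (\<exists>k\<in>J. k \<noteq> i \<and> f k \<le> f i)"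
    proof cases
      case 1
      then show ?thesis using le by (metis ereal_infty_less_eq(1))
    next
      case 2
      then show ?thesis using le by metis
    qed
  next
    assume r: "\<forall>i\<in>J. f i \<noteq> \<infinity> \<longrightarrow> (\<exists>k\<in>J. k \<noteq> i \<and> f k \<le> f i)"
    show "min_twice f J"
    proof (cases "?\<mu> = \<infinity>")
      case False
      then obtain k where "k \<in> J" "k \<noteq> a" "f k \<le> ?\<mu>"
        using r a by metis
      then show ?thesis
        unfolding min_twice_def using a le by (metis antisym)
    qed (simp add: min_twice_def)
  qed
qed

locale valuated_matroid =
  fixes m :: nat and p :: "'n::finite set \<Rightarrow> ereal"
  assumes pluecker: "tropical_pluecker m p"
begin

abbreviation "\<B> \<equiv> bases m p"

text \<open>
  Real-valued versions of \<open>p\<close> and of the weight, so that arithmetic takes place in the reals.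
\<close>

definition val :: "'n set \<Rightarrow> real" where "val A = real_of_ereal (p A)"

definition wt :: "real ^ 'n \<Rightarrow> 'n set \<Rightarrow> real" where "wt v A = (\<Sum>i\<in>A. v $ i) - val A"

lemma p_basis: "A \<in> \<B> \<Longrightarrow> p A = ereal (val A)"
  using pluecker by (auto simp: bases_def tropical_pluecker_def val_def ereal_real)

lemma p_nonbasis: "card A = m \<Longrightarrow> A \<notin> \<B> \<Longrightarrow> p A = \<infinity>"
  by (auto simp: bases_def)

lemma card_basis: "A \<in> \<B> \<Longrightarrow> card A = m"
  by (simp add: bases_def)

lemma card_swap:
  fixes A :: "'n set"
  shows "card A = m \<Longrightarrow> a \<in> A \<Longrightarrow> i \<notin> A \<Longrightarrow> card (insert i (A - {a})) = m"
  using card_Suc_Diff1[of A a] finite[of A] by simp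

lemma weight_basis: "A \<in> \<B> \<Longrightarrow> weight p v A = ereal (wt v A)"
  by (simp add: weight_def p_basis wt_def)

lemma initial_bases_alt:
  "initial_bases m p v = {A \<in> \<B>. \<forall>A'\<in>\<B>. wt v A' \<le> wt v A}"
  unfolding initial_bases_def by (auto simp: weight_basis)

lemma wt_swap:
  assumes "b \<in> B" "i \<notin> B"
  shows "wt v (insert i (B - {b})) = wt v B + v $ i - v $ b - (val (insert i (B - {b})) - val B)"
  using assms by (simp add: wt_def sum_diff1)

text \<open>
  An exchange moves \<open>i\<close> and \<open>b\<close> from one set to the other, so the total linear part of the two
  weights is preserved and the gap is the same for all \<open>v\<close>.
\<close>

lemma wt_exchange_gap:
  assumes "i \<in> A" "i \<notin> B" "b \<in> B" "b \<notin> A"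
  shows "wt v (insert b (A - {i})) + wt v (insert i (B - {b})) - (wt v A + wt v B) =
    val A + val B - (val (insert b (A - {i})) + val (insert i (B - {b})))"
  using wt_swap[of i A b v] wt_swap[of b B i v] assms by simp

text \<open>
  The tropical Pluecker relation for \<open>S = A - {i}\<close> and \<open>T = B \<union> {i}\<close>: its term at \<open>i\<close> is
  \<open>p A + p B\<close>, and some other term is at most as large.  This is the symmetric exchange
  axiom of a valuated matroid.
\<close>

lemma exchange:
  assumes A: "A \<in> \<B>" and B: "B \<in> \<B>" and i: "i \<in> A" "i \<notin> B"
  obtains b where "b \<in> B" "b \<notin> A" "insert b (A - {i}) \<in> \<B>" "insert i (B - {b}) \<in> \<B>"
    "\<And>v. wt v A + wt v B \<le> wt v (insert b (A - {i})) + wt v (insert i (B - {b}))"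
proof -
  let ?S = "A - {i}" and ?T = "insert i B"
  let ?f = "\<lambda>k. p (?S \<union> {k}) + p (?T - {k})"
  have card: "card ?S = m - 1" "card ?T = m + 1"
    using card_basis[OF A] card_basis[OF B] i by auto
  then have "min_twice ?f (?T - ?S)"
    using pluecker unfolding tropical_pluecker_def by blast
  then have two: "\<forall>k\<in>?T - ?S. ?f k \<noteq> \<infinity> \<longrightarrow> (\<exists>l\<in>?T - ?S. l \<noteq> k \<and> ?f l \<le> ?f k)"
    by (subst (asm) min_twice_iff) auto
  have fi: "?f i = ereal (val A + val B)"
    using i p_basis[OF A] p_basis[OF B] by (simp add: insert_absorb)
  then obtain b where b: "b \<in> ?T - ?S" "b \<noteq> i" "?f b \<le> ereal (val A + val B)"
    using two i by (metis Diff_iff PInfty_neq_ereal(1) insertI1)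
  then have bB: "b \<in> B" "b \<notin> A"
    by auto
  have S: "?S \<union> {b} = insert b (A - {i})" and T: "?T - {b} = insert i (B - {b})"
    using b(2) by auto
  have c: "card (insert b (A - {i})) = m" "card (insert i (B - {b})) = m"
    using card_swap[OF card_basis[OF A] i(1) bB(2)] card_swap[OF card_basis[OF B] bB(1) i(2)] .
  have "p (insert b (A - {i})) \<noteq> -\<infinity>" "p (insert i (B - {b})) \<noteq> -\<infinity>"
    using pluecker c unfolding tropical_pluecker_def by auto
  then have bs: "insert b (A - {i}) \<in> \<B>" "insert i (B - {b}) \<in> \<B>"
    using b(3) c unfolding S T bases_def by auto
  show ?thesis
  proof (rule that[OF bB bs])
    fix v
    have "val (insert b (A - {i})) + val (insert i (B - {b})) \<le> val A + val B"
      using b(3) p_basis[OF bs(1)] p_basis[OF bs(2)] unfolding S T by simp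
    then show "wt v A + wt v B \<le> wt v (insert b (A - {i})) + wt v (insert i (B - {b}))"
      using wt_exchange_gap[OF i bB, of v] by linarith
  qed
qed

lemma swap_closer:
  fixes A B :: "'n set"
  assumes "i \<in> A" "i \<notin> B" "b \<in> B" "b \<notin> A"
  shows "card (insert b (A - {i}) - B) < card (A - B)"
proof -
  have "insert b (A - {i}) - B = (A - B) - {i}" using assms by auto
  moreover have "card (A - B - {i}) < card (A - B)"
    using assms by (intro card_Diff1_less) auto
  ultimately show ?thesis by simp
qed

lemma basis_diff_nonempty:
  assumes "A \<in> \<B>" "B \<in> \<B>" "A \<noteq> B"
  obtains i where "i \<in> A" "i \<notin> B"
  using assms card_basis card_subset_eq[of B A] by (metis finite subsetI)

text \<open>
  A local maximum of the weight is global: exchanging a basis \<open>A\<close> with \<open>B\<close> gives a basis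
  closer to \<open>B\<close> whose weight is at least that of \<open>A\<close>, as the neighbour of \<open>B\<close>
  produced at the same time does not beat \<open>B\<close>.
\<close>

lemma initial_basis_iff_local:
  assumes B: "B \<in> \<B>"
  shows "B \<in> initial_bases m p v \<longleftrightarrow>
    (\<forall>i b. i \<notin> B \<longrightarrow> b \<in> B \<longrightarrow> insert i (B - {b}) \<in> \<B> \<longrightarrow> wt v (insert i (B - {b})) \<le> wt v B)"
    (is "_ \<longleftrightarrow> ?local")
proof
  assume loc: ?local
  have "wt v A \<le> wt v B" if "A \<in> \<B>" for A
    using that
  proof (induction "card (A - B)" arbitrary: A rule: less_induct)
    case less
    show ?case
    proof (cases "A = B")
      case False
      then obtain i where i: "i \<in> A" "i \<notin> B"
        using basis_diff_nonempty less.prems B by metis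
      obtain b where b: "b \<in> B" "b \<notin> A" "insert b (A - {i}) \<in> \<B>" "insert i (B - {b}) \<in> \<B>"
        "wt v A + wt v B \<le> wt v (insert b (A - {i})) + wt v (insert i (B - {b}))"
        using exchange[OF less.prems B i] by metis
      have "wt v (insert b (A - {i})) \<le> wt v B"
        using less.hyps[OF swap_closer[OF i b(1,2)] b(3)] .
      moreover have "wt v (insert i (B - {b})) \<le> wt v B"
        using loc i b by blast
      ultimately show ?thesis using b(5) by linarith
    qed simp
  qed
  then show "B \<in> initial_bases m p v"
    using B by (simp add: initial_bases_alt)
qed (auto simp: initial_bases_alt)

text \<open>
  Geometrically, a cell of the matroid subdivision induced by \<open>p\<close> is determined by its edge
  directions at the vertex \<open>B\<close>.  A basis \<open>A\<close> of maximal weight for \<open>v\<close> is exchanged with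
  \<open>B\<close>; both resulting bases are again maximal for \<open>v\<close>, hence for \<open>v'\<close> by induction and by
  the hypothesis on neighbours of \<open>B\<close>.  So the gap of the exchange vanishes, for \<open>v\<close> and therefore
  for \<open>v'\<close>, which makes \<open>A\<close> maximal for \<open>v'\<close>.
\<close>

lemma initial_bases_subset_iff:
  assumes B: "B \<in> initial_bases m p v" "B \<in> initial_bases m p v'"
  shows "initial_bases m p v \<subseteq> initial_bases m p v' \<longleftrightarrow>
    (\<forall>i b. i \<notin> B \<longrightarrow> b \<in> B \<longrightarrow> insert i (B - {b}) \<in> initial_bases m p v
        \<longrightarrow> insert i (B - {b}) \<in> initial_bases m p v')"
    (is "_ \<longleftrightarrow> ?local")
proof
  assume loc: ?local
  have BB: "B \<in> \<B>" using B by (simp add: initial_bases_alt)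
  have init: "A \<in> initial_bases m p w \<longleftrightarrow> wt w A = wt w B" if "A \<in> \<B>" "B \<in> initial_bases m p w" for A w
    using that by (auto simp: initial_bases_alt intro: antisym)
  have "wt v' A = wt v' B" if "A \<in> initial_bases m p v" for A
    using that
  proof (induction "card (A - B)" arbitrary: A rule: less_induct)
    case less
    then have AB: "A \<in> \<B>" by (simp add: initial_bases_alt)
    show ?case
    proof (cases "A = B")
      case False
      then obtain i where i: "i \<in> A" "i \<notin> B"
        using basis_diff_nonempty AB BB by metis
      obtain b where b: "b \<in> B" "b \<notin> A" "insert b (A - {i}) \<in> \<B>" "insert i (B - {b}) \<in> \<B>"
        and ex: "\<And>w. wt w A + wt w B \<le> wt w (insert b (A - {i})) + wt w (insert i (B - {b}))"
        using exchange[OF AB BB i] by metis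
      note gap = wt_exchange_gap[OF i b(1,2)]
      let ?A' = "insert b (A - {i})" and ?B' = "insert i (B - {b})"
      have "wt v ?A' \<le> wt v B" "wt v ?B' \<le> wt v B" "wt v A = wt v B"
        using B(1) b init[OF AB B(1)] less.prems by (auto simp: initial_bases_alt)
      with ex[of v] have eq: "wt v ?A' = wt v B" "wt v ?B' = wt v B" by linarith+
      then have "?A' \<in> initial_bases m p v" "?B' \<in> initial_bases m p v"
        using init b B by auto
      then have "wt v' ?A' = wt v' B" "wt v' ?B' = wt v' B"
        using less.hyps[OF swap_closer[OF i b(1,2)]] loc i b init[OF b(4) B(2)] by auto
      then show ?thesis
        using gap[of v] gap[of v'] eq \<open>wt v A = wt v B\<close> by linarith
    qed simp
  qed
  then show "initial_bases m p v \<subseteq> initial_bases m p v'"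
    using init[OF _ B(2)] by (auto simp: initial_bases_alt)
qed auto

text \<open>
  On \<open>S - {k}\<close> the weight is the constant \<open>\<Sum>i\<in>S. v $ i\<close> minus the term that \<open>k\<close>
  contributes to the orthogonality of \<open>v\<close> with the circuit of \<open>S\<close>.  Hence minimal terms are bases
  inside \<open>S\<close> of maximal weight.
\<close>

lemma real_point_in_linear_space_iff:
  "(\<chi> i. ereal (v $ i)) \<in> trop_linear_space m p \<longleftrightarrow>
    (\<forall>S i. card S = m + 1 \<longrightarrow> i \<in> S \<longrightarrow> S - {i} \<in> \<B> \<longrightarrow>
      (\<exists>k\<in>S. k \<noteq> i \<and> S - {k} \<in> \<B> \<and> wt v (S - {i}) \<le> wt v (S - {k})))"
    (is "?x \<in> _ \<longleftrightarrow> (\<forall>S i. card S = m + 1 \<longrightarrow> ?cond S i)")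
proof -
  have orth: "trop_orthogonal ?x (\<chi> i. circuit_vec p S $ i + ereal t) \<longleftrightarrow> (\<forall>i. ?cond S i)"
    if S: "card S = m + 1" for S t
  proof -
    define f where "f i = ?x $ i + (\<chi> i. circuit_vec p S $ i + ereal t) $ i" for i
    have f: "f i = (if i \<in> S \<and> S - {i} \<in> \<B> then ereal (sum (($) v) S + t - wt v (S - {i})) else \<infinity>)" for i
    proof (cases "i \<in> S")
      case True
      then have "card (S - {i}) = m" using S by simp
      then show ?thesis
        using True by (auto simp: f_def circuit_vec_def p_basis p_nonbasis wt_def sum_diff1)
    qed (simp add: f_def circuit_vec_def)
    have "trop_orthogonal ?x (\<chi> i. circuit_vec p S $ i + ereal t) \<longleftrightarrow> min_twice f UNIV"
      unfolding trop_orthogonal_def f_def ..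
    also have "\<dots> \<longleftrightarrow> (\<forall>i. f i \<noteq> \<infinity> \<longrightarrow> (\<exists>k. k \<noteq> i \<and> f k \<le> f i))"
      by (subst min_twice_iff) auto
    also have "\<dots> \<longleftrightarrow> (\<forall>i. ?cond S i)"
      by (rule iff_allI) (auto simp: f)
    finally show ?thesis .
  qed
  have nontrivial: "circuit_vec p S \<noteq> (\<chi> i. \<infinity>)" if "i \<in> S" "S - {i} \<in> \<B>" for S i
    using that by (auto simp: circuit_vec_def vec_eq_iff p_basis intro!: exI[of _ i])
  show ?thesis
  proof
    assume x: "?x \<in> trop_linear_space m p"
    show "\<forall>S i. card S = m + 1 \<longrightarrow> ?cond S i"
    proof (intro allI impI)
      fix S i assume S: "card S = m + 1" and i: "i \<in> S" "S - {i} \<in> \<B>"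
      then have "(\<chi> i. circuit_vec p S $ i + ereal 0) \<in> circuits m p"
        using nontrivial unfolding circuits_def by blast
      then have "trop_orthogonal ?x (\<chi> i. circuit_vec p S $ i + ereal 0)"
        using x unfolding trop_linear_space_def by blast
      then show "\<exists>k\<in>S. k \<noteq> i \<and> S - {k} \<in> \<B> \<and> wt v (S - {i}) \<le> wt v (S - {k})"
        using orth[OF S] i by blast
    qed
  next
    assume "\<forall>S i. card S = m + 1 \<longrightarrow> ?cond S i"
    then have "trop_orthogonal ?x c" if "c \<in> circuits m p" for c
      using that orth unfolding circuits_def by blast
    then show "?x \<in> trop_linear_space m p"
      by (simp add: trop_linear_space_def)
  qed
qed

text \<open>
  The right-hand side says that the initial matroid at \<open>v\<close> has no loops: an element outside
  \<open>B\<close> lies in some initial basis iff it can be exchanged into \<open>B\<close>.  From left to right one tests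
  orthogonality only with the fundamental circuits of \<open>B\<close>.
\<close>

lemma in_linear_space_iff_loopless_at:
  assumes B: "B \<in> initial_bases m p v"
  shows "(\<chi> i. ereal (v $ i)) \<in> trop_linear_space m p \<longleftrightarrow>
    (\<forall>i. i \<notin> B \<longrightarrow> (\<exists>b\<in>B. insert i (B - {b}) \<in> initial_bases m p v))"
    (is "_ \<longleftrightarrow> ?loopless")
  unfolding real_point_in_linear_space_iff
proof (intro iffI allI impI)
  fix i assume "\<forall>S i. card S = m + 1 \<longrightarrow> i \<in> S \<longrightarrow> S - {i} \<in> \<B> \<longrightarrow>
      (\<exists>k\<in>S. k \<noteq> i \<and> S - {k} \<in> \<B> \<and> wt v (S - {i}) \<le> wt v (S - {k}))"
    and i: "i \<notin> B"
  moreover have BB: "B \<in> \<B>" using B by (simp add: initial_bases_alt)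
  ultimately obtain k where k: "k \<in> B" "k \<noteq> i" "insert i B - {k} \<in> \<B>" "wt v B \<le> wt v (insert i B - {k})"
    using card_basis[OF BB] by (metis Diff_insert_absorb Suc_eq_plus1 card_insert_disjoint finite insertE insertI1)
  then have "insert i B - {k} = insert i (B - {k})" by auto
  with k show "\<exists>b\<in>B. insert i (B - {b}) \<in> initial_bases m p v"
    using B by (auto simp: initial_bases_alt intro: order_trans)
next
  fix S k assume loopless: ?loopless and S: "card S = m + 1" "k \<in> S" "S - {k} \<in> \<B>"
  have "\<exists>A\<in>initial_bases m p v. k \<in> A"
    using loopless B by (metis insertI1)
  then obtain A where A: "A \<in> initial_bases m p v" "k \<in> A"
    by blast
  then have AB: "A \<in> \<B>"
    by (simp add: initial_bases_alt)
  have kS: "k \<notin> S - {k}"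
    by simp
  \<comment> \<open>Exchanging \<open>k\<close> out of the maximal basis \<open>A\<close> cannot increase its weight, so the exchange
     cannot decrease the weight of \<open>S - {k}\<close>.\<close>
  obtain a where a: "a \<in> S - {k}" "a \<notin> A" "insert a (A - {k}) \<in> \<B>" "insert k (S - {k} - {a}) \<in> \<B>"
    and ex: "\<And>v. wt v A + wt v (S - {k}) \<le> wt v (insert a (A - {k})) + wt v (insert k (S - {k} - {a}))"
    by (rule exchange[OF AB S(3) A(2) kS], rule that)
  have "wt v (insert a (A - {k})) \<le> wt v A"
    using A a(3) by (simp add: initial_bases_alt)
  moreover have eq: "insert k (S - {k} - {a}) = S - {a}"
    using S(2) a(1) by blast
  ultimately have "wt v (S - {k}) \<le> wt v (S - {a})"
    using ex[of v] by simp
  then show "\<exists>a\<in>S. a \<noteq> k \<and> S - {a} \<in> \<B> \<and> wt v (S - {k}) \<le> wt v (S - {a})"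
    using a(1,4) unfolding eq by blast
qed

end

section \<open>The local tropical linear space as a graph\<close>

text \<open>
  The data of the local linear space at \<open>B\<close>: \<open>\<beta>\<close> numbers the elements of \<open>B\<close> and \<open>\<iota>\<close> those
  of the complement, and the valuations of the neighbours of \<open>B\<close> relative to that of \<open>B\<close>
  are recorded as the supports \<open>I\<close> and the heights \<open>h\<close>.
\<close>

locale based_valuated_matroid = valuated_matroid m p
  for m :: nat and p :: "'n::finite set \<Rightarrow> ereal" +
  fixes B :: "'n set" and \<beta> :: "'m::finite \<Rightarrow> 'n"
    and J :: "'j set" and \<iota> :: "'j \<Rightarrow> 'n"
    and I :: "'j \<Rightarrow> 'm set" and h :: "'j \<Rightarrow> 'm \<Rightarrow> real"
  assumes B: "B \<in> bases m p"
    and \<beta>: "bij_betw \<beta> UNIV B"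
    and \<iota>: "bij_betw \<iota> J (- B)"
    and I_nonempty: "\<And>j. j \<in> J \<Longrightarrow> I j \<noteq> {}"
    and I_iff: "\<And>j k. j \<in> J \<Longrightarrow> k \<in> I j \<longleftrightarrow> insert (\<iota> j) (B - {\<beta> k}) \<in> bases m p"
    and h: "\<And>j k. j \<in> J \<Longrightarrow> k \<in> I j \<Longrightarrow>
      p (insert (\<iota> j) (B - {\<beta> k})) = p B + ereal (h j k)"
begin

abbreviation "L \<equiv> local_trop_linear_space m p B"

text \<open>
  The coordinates in \<open>B\<close>, negated because the vertices of a mixed subdivision cell minimize
  \<open>h j k - u $ k\<close> whereas the local linear space involves minima of \<open>h j k + v $ \<beta> k\<close>.
\<close>

definition chart :: "real ^ 'n \<Rightarrow> real ^ 'm" where "chart v = (\<chi> k. - v $ \<beta> k)"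

abbreviation "tight v j \<equiv> min_vertices (h j) (I j) (chart v)"

lemma outside: "i \<notin> B \<longleftrightarrow> (\<exists>j\<in>J. i = \<iota> j)"
  using \<iota> by (auto simp: bij_betw_def)

lemma inside: "i \<in> B \<longleftrightarrow> (\<exists>k. i = \<beta> k)"
  using \<beta> by (auto simp: bij_betw_def)

lemma all_swaps_iff:
  "(\<forall>i b. i \<notin> B \<longrightarrow> b \<in> B \<longrightarrow> Q i b) \<longleftrightarrow> (\<forall>j\<in>J. \<forall>k. Q (\<iota> j) (\<beta> k))"
proof -
  have "(\<forall>i b. i \<notin> B \<longrightarrow> b \<in> B \<longrightarrow> Q i b) \<longleftrightarrow> (\<forall>i. i \<notin> B \<longrightarrow> (\<forall>k. Q i (\<beta> k)))"
    unfolding inside by blast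
  then show ?thesis
    unfolding outside by blast
qed

lemma wt_neighbour:
  assumes "j \<in> J" "k \<in> I j"
  shows "wt v (insert (\<iota> j) (B - {\<beta> k})) = wt v B + v $ \<iota> j - (h j k + v $ \<beta> k)"
proof -
  have "val (insert (\<iota> j) (B - {\<beta> k})) = val B + h j k"
    using h[OF assms] p_basis[OF B] p_basis[of "insert (\<iota> j) (B - {\<beta> k})"] I_iff assms by simp
  then show ?thesis
    using wt_swap[of "\<beta> k" B "\<iota> j" v] inside outside assms(1) by force
qed

lemma initial_basis_iff_inequalities:
  "B \<in> initial_bases m p v \<longleftrightarrow> (\<forall>j\<in>J. \<forall>k\<in>I j. v $ \<iota> j \<le> h j k + v $ \<beta> k)"
  unfolding initial_basis_iff_local[OF B] all_swaps_iff
proof (intro ball_cong refl)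
  fix j assume j: "j \<in> J"
  show "(\<forall>k. insert (\<iota> j) (B - {\<beta> k}) \<in> \<B> \<longrightarrow> wt v (insert (\<iota> j) (B - {\<beta> k})) \<le> wt v B) \<longleftrightarrow>
      (\<forall>k\<in>I j. v $ \<iota> j \<le> h j k + v $ \<beta> k)"
    using wt_neighbour[OF j, of _ v] by (auto simp: Ball_def simp flip: I_iff[OF j])
qed

lemma neighbour_initial_iff:
  assumes "B \<in> initial_bases m p v" "j \<in> J"
  shows "insert (\<iota> j) (B - {\<beta> k}) \<in> initial_bases m p v \<longleftrightarrow>
    k \<in> I j \<and> v $ \<iota> j = h j k + v $ \<beta> k"
proof -
  have "A \<in> initial_bases m p v \<longleftrightarrow> A \<in> \<B> \<and> wt v A = wt v B" for A
    using assms(1) by (auto simp: initial_bases_alt intro: antisym)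
  then show ?thesis
    using wt_neighbour[OF assms(2)] I_iff[OF assms(2)] by auto
qed

text \<open>
  The local linear space is the graph of a tropical linear map: the coordinates outside \<open>B\<close>
  are minima of coordinates in \<open>B\<close> shifted by heights.  The inequalities express that \<open>B\<close> is
  initial, and equality somewhere that \<open>\<iota> j\<close> is not a loop of the initial matroid.
\<close>

lemma local_space_iff_graph:
  "v \<in> L \<longleftrightarrow> (\<forall>j\<in>J. (\<forall>k\<in>I j. v $ \<iota> j \<le> h j k + v $ \<beta> k) \<and>
     (\<exists>k\<in>I j. v $ \<iota> j = h j k + v $ \<beta> k))"
proof -
  have all_i: "(\<forall>i. i \<notin> B \<longrightarrow> (\<exists>b\<in>B. insert i (B - {b}) \<in> initial_bases m p v)) \<longleftrightarrow>
      (\<forall>j\<in>J. \<exists>k. insert (\<iota> j) (B - {\<beta> k}) \<in> initial_bases m p v)"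
  proof -
    have "(\<exists>b\<in>B. Q b) \<longleftrightarrow> (\<exists>k. Q (\<beta> k))" for Q
      unfolding Bex_def inside by blast
    then show ?thesis
      unfolding outside by auto
  qed
  have "v \<in> L \<longleftrightarrow> B \<in> initial_bases m p v \<and>
      (\<forall>j\<in>J. \<exists>k. insert (\<iota> j) (B - {\<beta> k}) \<in> initial_bases m p v)"
    unfolding local_trop_linear_space_def
    using in_linear_space_iff_loopless_at[of B v] all_i by auto
  then show ?thesis
    using neighbour_initial_iff initial_basis_iff_inequalities by blast
qed

lemma tight_iff:
  assumes "v \<in> L" "j \<in> J"
  shows "k \<in> tight v j \<longleftrightarrow> k \<in> I j \<and> v $ \<iota> j = h j k + v $ \<beta> k"
proof -
  have le: "v $ \<iota> j \<le> h j k + v $ \<beta> k" if "k \<in> I j" for k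
    using assms that by (simp add: local_space_iff_graph)
  obtain k0 where k0: "k0 \<in> I j" "v $ \<iota> j = h j k0 + v $ \<beta> k0"
    using assms by (auto simp: local_space_iff_graph)
  have "k \<in> tight v j \<longleftrightarrow> k \<in> I j \<and> (\<forall>l\<in>I j. h j k + v $ \<beta> k \<le> h j l + v $ \<beta> l)"
    by (simp add: min_vertices_def chart_def)
  also have "\<dots> \<longleftrightarrow> k \<in> I j \<and> v $ \<iota> j = h j k + v $ \<beta> k"
    using le k0 by (metis antisym)
  finally show ?thesis .
qed

lemma local_space_tight:
  assumes "v \<in> L" "j \<in> J"
  shows "tight v j \<noteq> {}"
  using min_vertices_nonempty I_nonempty assms by metis

lemma initial_bases_subset_iff_tight:
  assumes "v \<in> L" "w \<in> L"
  shows "initial_bases m p v \<subseteq> initial_bases m p w \<longleftrightarrow> (\<forall>j\<in>J. tight v j \<subseteq> tight w j)"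
proof -
  have init: "B \<in> initial_bases m p v" "B \<in> initial_bases m p w"
    using assms by (auto simp: local_trop_linear_space_def)
  have "initial_bases m p v \<subseteq> initial_bases m p w \<longleftrightarrow>
      (\<forall>j\<in>J. \<forall>k. insert (\<iota> j) (B - {\<beta> k}) \<in> initial_bases m p v \<longrightarrow>
        insert (\<iota> j) (B - {\<beta> k}) \<in> initial_bases m p w)"
    unfolding initial_bases_subset_iff[OF init] by (rule all_swaps_iff)
  also have "\<dots> \<longleftrightarrow> (\<forall>j\<in>J. tight v j \<subseteq> tight w j)"
    using neighbour_initial_iff init tight_iff assms by (auto simp: subset_iff)
  finally show ?thesis .
qed

lemma initial_bases_eq_iff_tight:
  assumes "v \<in> L" "w \<in> L"
  shows "initial_bases m p v = initial_bases m p w \<longleftrightarrow> (\<forall>j\<in>J. tight v j = tight w j)"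
  using initial_bases_subset_iff_tight assms by (simp add: set_eq_subset) blast

lemma chart_onto: "chart ` L = UNIV"
proof -
  have "\<exists>v\<in>L. chart v = u" for u
  proof -
    define \<mu> where "\<mu> j = Min ((\<lambda>k. h j k - u $ k) ` I j)" for j
    define v :: "real ^ 'n" where
      "v = (\<chi> i. if i \<in> B then - u $ (inv \<beta> i) else \<mu> (inv_into J \<iota> i))"
    have v\<beta>: "v $ \<beta> k = - u $ k" for k
      using \<beta> by (auto simp: v_def bij_betw_def)
    have v\<iota>: "v $ \<iota> j = \<mu> j" if "j \<in> J" for j
      using \<iota> that outside[of "\<iota> j"] by (auto simp: v_def bij_betw_def)
    have "\<mu> j \<le> h j k - u $ k" if "k \<in> I j" for j k
      using that by (simp add: \<mu>_def)
    moreover have "\<exists>k\<in>I j. \<mu> j = h j k - u $ k" if "j \<in> J" for j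
      using Min_in[of "(\<lambda>k. h j k - u $ k) ` I j"] I_nonempty[OF that] by (simp add: \<mu>_def image_iff)
    ultimately have "v \<in> L"
      by (simp add: local_space_iff_graph v\<beta> v\<iota>)
    moreover have "chart v = u"
      by (simp add: chart_def v\<beta> vec_eq_iff)
    ultimately show ?thesis by blast
  qed
  then show ?thesis by (metis UNIV_eq_I imageI)
qed

abbreviation "stratum v \<equiv> {v' \<in> L. initial_bases m p v' = initial_bases m p v}"

lemma closure_stratum_tight:
  assumes v: "v \<in> L" and w: "w \<in> L" "w \<in> closure (stratum v)" and j: "j \<in> J"
  shows "tight v j \<subseteq> tight w j"
proof
  fix k assume k: "k \<in> tight v j"
  have "closed {x. x $ \<iota> j = h j k + x $ \<beta> k}"
    by (intro closed_Collect_eq continuous_intros)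
  moreover have "stratum v \<subseteq> {x. x $ \<iota> j = h j k + x $ \<beta> k}"
  proof
    fix x assume x: "x \<in> stratum v"
    then have "k \<in> tight x j"
      using initial_bases_eq_iff_tight[OF _ v] j k by auto
    then show "x \<in> {x. x $ \<iota> j = h j k + x $ \<beta> k}"
      using tight_iff x j by blast
  qed
  ultimately have "w $ \<iota> j = h j k + w $ \<beta> k"
    using closure_minimal w(2) by blast
  then show "k \<in> tight w j"
    using k tight_iff v w(1) j by blast
qed

text \<open>
  All inequalities between heights hold at both ends of the segment, so along it an equality can
  hold only if it holds at \<open>v\<close>; and those that hold at \<open>v\<close> also hold at \<open>w\<close> by assumption.
\<close>

lemma segment_in_stratum:
  assumes v: "v \<in> L" and w: "w \<in> L" and sub: "\<forall>j\<in>J. tight v j \<subseteq> tight w j"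
    and t: "0 < t" "t \<le> 1"
  shows "w + t *\<^sub>R (v - w) \<in> stratum v"
proof -
  define z where "z = w + t *\<^sub>R (v - w)"
  \<comment> \<open>The slack of the inequality indexed by \<open>j\<close> and \<open>k\<close>; it vanishes iff \<open>k\<close> is tight.\<close>
  define gap where "gap x j k = h j k + x $ \<beta> k - x $ \<iota> j" for x :: "real ^ 'n" and j k
  have z: "gap z j k = (1 - t) * gap w j k + t * gap v j k" for j k
    by (simp add: z_def gap_def algebra_simps)
  have nonneg: "0 \<le> gap x j k" and zero: "gap x j k = 0 \<longleftrightarrow> k \<in> tight x j"
    if "x \<in> L" "j \<in> J" "k \<in> I j" for x j k
    using that tight_iff[OF that(1,2)] by (auto simp: gap_def local_space_iff_graph)
  have z_nonneg: "0 \<le> gap z j k" and z_zero: "gap z j k = 0 \<longleftrightarrow> k \<in> tight v j"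
    if "j \<in> J" "k \<in> I j" for j k
  proof -
    have v0: "0 \<le> t * gap v j k" and w0: "0 \<le> (1 - t) * gap w j k"
      using nonneg v w that t by simp_all
    then show "0 \<le> gap z j k" by (simp add: z)
    have "gap v j k = 0 \<Longrightarrow> gap w j k = 0"
      using zero v w that sub by blast
    then have "gap z j k = 0 \<longleftrightarrow> gap v j k = 0"
      using v0 w0 t unfolding z by (smt (verit) mult_eq_0_iff)
    then show "gap z j k = 0 \<longleftrightarrow> k \<in> tight v j"
      using zero v that by simp
  qed
  have "z \<in> L"
    unfolding local_space_iff_graph
  proof (intro ballI conjI)
    fix j assume j: "j \<in> J"
    show "z $ \<iota> j \<le> h j k + z $ \<beta> k" if "k \<in> I j" for k
      using z_nonneg[OF j that] by (simp add: gap_def)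
    obtain k where "k \<in> tight v j" "k \<in> I j"
      using local_space_tight[OF v j] by (auto simp: min_vertices_def)
    then show "\<exists>k\<in>I j. z $ \<iota> j = h j k + z $ \<beta> k"
      using z_zero[OF j] by (force simp: gap_def)
  qed
  moreover have "tight z j = tight v j" if "j \<in> J" for j
    using z_zero[OF that] zero[OF \<open>z \<in> L\<close> that] by (auto simp: min_vertices_def)
  ultimately show ?thesis
    using initial_bases_eq_iff_tight v by (simp add: z_def)
qed

lemma stratum_subset_closure:
  assumes v: "v \<in> L" and w: "w \<in> L" and sub: "\<forall>j\<in>J. tight v j \<subseteq> tight w j"
  shows "w \<in> closure (stratum v)"
  unfolding closure_sequential
proof (intro exI conjI allI)
  let ?z = "\<lambda>n. w + inverse (real (Suc n)) *\<^sub>R (v - w)"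
  show "?z n \<in> stratum v" for n
    by (rule segment_in_stratum[OF v w sub]) (auto simp: field_simps)
  have "?z \<longlonglongrightarrow> w + 0 *\<^sub>R (v - w)"
    by (intro tendsto_intros LIMSEQ_inverse_real_of_nat)
  then show "?z \<longlonglongrightarrow> w" by simp
qed

text \<open>
  The closure of a stratum consists of the points of the local linear space where at least
  the equalities of that stratum hold, so larger cells have fewer equalities.
\<close>

lemma cell_subset_iff:
  assumes v: "v \<in> L" and w: "w \<in> L"
  shows "closure (stratum v) \<subseteq> closure (stratum w) \<longleftrightarrow> (\<forall>j\<in>J. tight w j \<subseteq> tight v j)"
proof
  assume "closure (stratum v) \<subseteq> closure (stratum w)"
  moreover have "v \<in> closure (stratum v)"
    using v by (intro subsetD[OF closure_subset]) simp
  ultimately show "\<forall>j\<in>J. tight w j \<subseteq> tight v j"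
    using closure_stratum_tight[OF w v] by blast
next
  assume "\<forall>j\<in>J. tight w j \<subseteq> tight v j"
  then have "x \<in> closure (stratum w)" if "x \<in> stratum v" for x
    using stratum_subset_closure[OF w, of x] initial_bases_eq_iff_tight[OF _ v, of x] that by simp
  then have "stratum v \<subseteq> closure (stratum w)"
    by blast
  then show "closure (stratum v) \<subseteq> closure (stratum w)"
    by (simp add: closure_minimal)
qed

end

section \<open>Tropical minors\<close>

text \<open>
  The tropical maximal minor of the \<open>m \<times> n\<close> matrix \<open>X\<close> in the columns \<open>A\<close>, that is, the least weight
  of a perfect matching of the rows with \<open>A\<close>; it is \<open>\<infinity>\<close> if there is none, as the infimum of the
  empty set.
\<close>

definition trop_minor :: "('m::finite \<Rightarrow> 'n \<Rightarrow> ereal) \<Rightarrow> 'n::finite set \<Rightarrow> ereal" where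
  "trop_minor X A = (INF \<sigma>\<in>{\<sigma>. bij_betw \<sigma> UNIV A}. \<Sum>k\<in>UNIV. X k (\<sigma> k))"

lemma trop_minor_le: "bij_betw \<sigma> UNIV A \<Longrightarrow> trop_minor X A \<le> (\<Sum>k\<in>UNIV. X k (\<sigma> k))"
  unfolding trop_minor_def by (rule INF_lower) simp

lemma trop_minor_attained:
  fixes X :: "'m::finite \<Rightarrow> 'n::finite \<Rightarrow> ereal"
  assumes "card A = CARD('m)"
  obtains \<sigma> where "bij_betw \<sigma> UNIV A" "trop_minor X A = (\<Sum>k\<in>UNIV. X k (\<sigma> k))"
proof -
  let ?M = "{\<sigma> :: 'm \<Rightarrow> 'n. bij_betw \<sigma> UNIV A}"
  have "?M \<noteq> {}"
    using assms finite_same_card_bij[of "UNIV :: 'm set" A] by auto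
  then have "trop_minor X A \<in> (\<lambda>\<sigma>. \<Sum>k\<in>UNIV. X k (\<sigma> k)) ` ?M"
    unfolding trop_minor_def by (subst Min_Inf [symmetric]) (auto intro!: Min_in)
  then show ?thesis
    using that by blast
qed

text \<open>
  Two matchings \<open>\<sigma>\<close> and \<open>\<tau>\<close> together form paths and cycles.  These are the rows on the path that
  starts in the column \<open>i\<close> with an edge of \<open>\<sigma>\<close>.
\<close>

inductive_set alternating_rows :: "('m \<Rightarrow> 'n) \<Rightarrow> ('m \<Rightarrow> 'n) \<Rightarrow> 'n \<Rightarrow> 'm set"
  for \<sigma> \<tau> :: "'m \<Rightarrow> 'n" and i :: 'n where
  start: "\<sigma> k = i \<Longrightarrow> k \<in> alternating_rows \<sigma> \<tau> i"
| step: "k \<in> alternating_rows \<sigma> \<tau> i \<Longrightarrow> \<sigma> l = \<tau> k \<Longrightarrow> l \<in> alternating_rows \<sigma> \<tau> i"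

text \<open>
  The column \<open>i\<close> is covered by \<open>\<sigma>\<close> only.  The alternating path starting there ends in a column
  \<open>j\<close> covered by \<open>\<tau>\<close> only, and interchanging \<open>\<sigma>\<close> and \<open>\<tau>\<close> along it preserves the total weight.
\<close>

lemma matching_exchange:
  fixes \<sigma> \<tau> :: "'m::finite \<Rightarrow> 'n::finite" and X :: "'m \<Rightarrow> 'n \<Rightarrow> ereal"
  assumes i: "i \<notin> S" "i \<in> T"
    and \<sigma>: "bij_betw \<sigma> UNIV (insert i S)" and \<tau>: "bij_betw \<tau> UNIV (T - {i})"
  obtains j \<sigma>' \<tau>' where "j \<in> T - S" "j \<noteq> i"
    "bij_betw \<sigma>' UNIV (insert j S)" "bij_betw \<tau>' UNIV (T - {j})"
    "(\<Sum>k\<in>UNIV. X k (\<sigma>' k)) + (\<Sum>k\<in>UNIV. X k (\<tau>' k)) =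
     (\<Sum>k\<in>UNIV. X k (\<sigma> k)) + (\<Sum>k\<in>UNIV. X k (\<tau> k))"
proof -
  let ?R = "alternating_rows \<sigma> \<tau> i"
  define \<sigma>' where "\<sigma>' k = (if k \<in> ?R then \<tau> k else \<sigma> k)" for k
  define \<tau>' where "\<tau>' k = (if k \<in> ?R then \<sigma> k else \<tau> k)" for k
  have inj: "inj \<sigma>" "inj \<tau>" and range: "range \<sigma> = insert i S" "range \<tau> = T - {i}"
    using \<sigma> \<tau> by (auto simp: bij_betw_def)
  have card: "card (insert i S) = CARD('m)" "card (T - {i}) = CARD('m)"
    using \<sigma> \<tau> by (metis bij_betw_same_card)+
  \<comment> \<open>A row on the path is the first one or is reached through the \<open>\<tau>\<close>-edge of the preceding row.\<close>
  have entered: "\<sigma> k = i \<or> (\<exists>l\<in>?R. \<sigma> k = \<tau> l)" if "k \<in> ?R" for k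
    using that by cases auto
  have inj': "inj \<sigma>'"
  proof (rule injI)
    fix k l assume "\<sigma>' k = \<sigma>' l"
    then show "k = l"
      using inj alternating_rows.step[of _ \<sigma> \<tau> i]
      by (auto simp: \<sigma>'_def inj_eq split: if_splits)
  qed
  have injt': "inj \<tau>'"
  proof (rule injI)
    have mix: False if "k \<in> ?R" "l \<notin> ?R" "\<sigma> k = \<tau> l" for k l
      using entered[OF that(1)] that range(2) inj(2) by (auto simp: inj_eq)
    fix k l assume "\<tau>' k = \<tau>' l"
    then show "k = l"
      using inj mix[of k l] mix[of l k] by (auto simp: \<tau>'_def inj_eq split: if_splits)
  qed
  have S_hit: "S \<subseteq> range \<sigma>'"
  proof
    fix s assume s: "s \<in> S"
    then obtain k where k: "s = \<sigma> k" using range(1) by auto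
    show "s \<in> range \<sigma>'"
    proof (cases "k \<in> ?R")
      case True
      then obtain l where "l \<in> ?R" "\<sigma> k = \<tau> l" using entered s i k by blast
      then have "\<sigma>' l = s" using k by (simp add: \<sigma>'_def)
      then show ?thesis by blast
    next
      case False
      then have "\<sigma>' k = s" using k by (simp add: \<sigma>'_def)
      then show ?thesis by blast
    qed
  qed
  have "card (range \<sigma>') = CARD('m)"
    using inj' by (simp add: card_image)
  moreover have "card S < CARD('m)"
    using card(1) i by simp
  ultimately have "\<not> range \<sigma>' \<subseteq> S"
    using card_mono[of S "range \<sigma>'"] by auto
  then obtain k where k: "\<sigma>' k \<notin> S" by blast
  have avoid: "\<sigma>' k \<noteq> i" for k
    using range(2) alternating_rows.start[of \<sigma> k i \<tau>] by (auto simp: \<sigma>'_def)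
  have kR: "k \<in> ?R"
  proof (rule ccontr)
    assume "k \<notin> ?R"
    then have "\<sigma> k \<notin> S" "\<sigma> k \<noteq> i" using k avoid[of k] by (auto simp: \<sigma>'_def)
    then show False using range(1) by blast
  qed
  \<comment> \<open>The last column of the path.\<close>
  define j where "j = \<tau> k"
  have j: "j \<in> T - S" "j \<noteq> i"
    using k kR range(2) by (auto simp: \<sigma>'_def j_def)
  have "insert j S = range \<sigma>'"
  proof (rule card_subset_eq)
    show "insert j S \<subseteq> range \<sigma>'"
      using S_hit kR by (auto simp: j_def \<sigma>'_def intro!: image_eqI[of _ _ k])
    show "card (insert j S) = card (range \<sigma>')"
      using j i card(1) \<open>card (range \<sigma>') = CARD('m)\<close> by simp
  qed simp
  then have b1: "bij_betw \<sigma>' UNIV (insert j S)"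
    using inj' by (simp add: bij_betw_def)
  have "\<tau>' l \<noteq> j" for l
  proof (cases "l \<in> ?R")
    case True
    have "\<sigma> l \<in> insert i S" using range(1) by blast
    then show ?thesis using True j by (auto simp: \<tau>'_def)
  next
    case False
    then show ?thesis using kR inj(2) by (auto simp: \<tau>'_def j_def inj_eq)
  qed
  moreover have "\<tau>' l \<in> T" for l
    using entered[of l] range(2) i(2) by (auto simp: \<tau>'_def)
  ultimately have sub: "range \<tau>' \<subseteq> T - {j}"
    by auto
  have "range \<tau>' = T - {j}"
  proof (rule card_subset_eq)
    show "card (range \<tau>') = card (T - {j})"
      using card(2) i(2) j(1) injt' by (simp add: card_image)
  qed (use sub in auto)
  then have b2: "bij_betw \<tau>' UNIV (T - {j})"
    using injt' by (simp add: bij_betw_def)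
  have "(\<Sum>k\<in>UNIV. X k (\<sigma>' k)) + (\<Sum>k\<in>UNIV. X k (\<tau>' k)) =
     (\<Sum>k\<in>UNIV. X k (\<sigma> k)) + (\<Sum>k\<in>UNIV. X k (\<tau> k))"
    unfolding sum.distrib [symmetric]
    by (intro sum.cong) (auto simp: \<sigma>'_def \<tau>'_def add.commute)
  then show ?thesis
    using that j b1 b2 by blast
qed

text \<open>
  The matching exchange, applied to optimal matchings for any given term of a Pluecker relation,
  yields another term that is at most as large.
\<close>

lemma tropical_pluecker_trop_minor:
  fixes X :: "'m::finite \<Rightarrow> 'n::finite \<Rightarrow> ereal"
  assumes X: "\<And>k i. X k i \<noteq> -\<infinity>" and A: "card A = CARD('m)" "trop_minor X A \<noteq> \<infinity>"
  shows "tropical_pluecker CARD('m) (trop_minor X)"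
  unfolding tropical_pluecker_def
proof (intro conjI allI impI)
  show "trop_minor X A \<noteq> -\<infinity>" if "card A = CARD('m)" for A
  proof -
    have "(\<Sum>k\<in>K. X k (\<sigma> k)) \<noteq> -\<infinity>" if "finite K" for K \<sigma>
      using that by induction (use X in auto)
    then show ?thesis
      using trop_minor_attained[OF that, of X] by (metis finite)
  qed
  show "\<exists>A. card A = CARD('m) \<and> trop_minor X A \<noteq> \<infinity>"
    using A by blast
  fix S T :: "'n set"
  assume card: "card S = CARD('m) - 1 \<and> card T = CARD('m) + 1"
  have "\<not> T \<subseteq> S"
    using card card_mono[of S T] by auto
  show "min_twice (\<lambda>i. trop_minor X (S \<union> {i}) + trop_minor X (T - {i})) (T - S)"
  proof (subst min_twice_iff)
    show "\<forall>i\<in>T - S. trop_minor X (S \<union> {i}) + trop_minor X (T - {i}) \<noteq> \<infinity> \<longrightarrow>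
        (\<exists>j\<in>T - S. j \<noteq> i \<and> trop_minor X (S \<union> {j}) + trop_minor X (T - {j})
            \<le> trop_minor X (S \<union> {i}) + trop_minor X (T - {i}))"
    proof (intro ballI impI)
      fix i assume i: "i \<in> T - S"
      have "card (insert i S) = CARD('m)" "card (T - {i}) = CARD('m)"
        using card i by auto
      then obtain \<sigma> \<tau> where \<sigma>: "bij_betw \<sigma> UNIV (insert i S)" "bij_betw \<tau> UNIV (T - {i})"
        and eq: "trop_minor X (insert i S) = (\<Sum>k\<in>UNIV. X k (\<sigma> k))"
          "trop_minor X (T - {i}) = (\<Sum>k\<in>UNIV. X k (\<tau> k))"
        using trop_minor_attained by metis
      obtain j \<sigma>' \<tau>' where j: "j \<in> T - S" "j \<noteq> i"
        and b: "bij_betw \<sigma>' UNIV (insert j S)" "bij_betw \<tau>' UNIV (T - {j})"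
        and sum: "(\<Sum>k\<in>UNIV. X k (\<sigma>' k)) + (\<Sum>k\<in>UNIV. X k (\<tau>' k)) =
          (\<Sum>k\<in>UNIV. X k (\<sigma> k)) + (\<Sum>k\<in>UNIV. X k (\<tau> k))"
        using matching_exchange[OF _ _ \<sigma>] i by (metis Diff_iff)
      have "trop_minor X (insert j S) + trop_minor X (T - {j})
          \<le> trop_minor X (insert i S) + trop_minor X (T - {i})"
        using add_mono[OF trop_minor_le[OF b(1)] trop_minor_le[OF b(2)], of X X] sum eq by simp
      then show "\<exists>j\<in>T - S. j \<noteq> i \<and> trop_minor X (S \<union> {j}) + trop_minor X (T - {j})
            \<le> trop_minor X (S \<union> {i}) + trop_minor X (T - {i})"
        using j by auto
    qed
  qed (use \<open>\<not> T \<subseteq> S\<close> in auto)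
qed

text \<open>
  The tropical identity matrix in the columns \<open>range \<beta>\<close>, next to the columns of heights indexed
  by \<open>J\<close>, with \<open>\<infinity>\<close> outside the supports.
\<close>

definition stiefel_matrix ::
    "('m \<Rightarrow> 'n) \<Rightarrow> 'j set \<Rightarrow> ('j \<Rightarrow> 'n) \<Rightarrow> ('j \<Rightarrow> 'm set) \<Rightarrow> ('j \<Rightarrow> 'm \<Rightarrow> real) \<Rightarrow> 'm \<Rightarrow> 'n \<Rightarrow> ereal" where
  "stiefel_matrix \<beta> J \<iota> I h k i =
    (if i \<in> range \<beta> then if i = \<beta> k then 0 else \<infinity>
     else let j = inv_into J \<iota> i in if k \<in> I j then ereal (h j k) else \<infinity>)"

text \<open>
  Next to the identity, the column set \<open>range \<beta>\<close> and its neighbours admit at most one matching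
  of finite weight: every row other than \<open>k\<close> has to be matched with its own identity column.
\<close>

lemma trop_minor_stiefel:
  fixes \<beta> :: "'m::finite \<Rightarrow> 'n::finite"
    and I :: "'j \<Rightarrow> 'm set" and h :: "'j \<Rightarrow> 'm \<Rightarrow> real"
  assumes \<beta>: "inj \<beta>" and \<iota>: "bij_betw \<iota> J (- range \<beta>)"
  defines "X \<equiv> stiefel_matrix \<beta> J \<iota> I h"
  shows "trop_minor X (range \<beta>) = 0"
    and "\<And>j k. j \<in> J \<Longrightarrow>
      trop_minor X (insert (\<iota> j) (range \<beta> - {\<beta> k})) = (if k \<in> I j then ereal (h j k) else \<infinity>)"
proof -
  have X\<beta>: "X k (\<beta> l) = (if l = k then 0 else \<infinity>)" for k l
    using \<beta> by (auto simp: X_def stiefel_matrix_def inj_eq)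
  have X\<iota>: "X k (\<iota> j) = (if k \<in> I j then ereal (h j k) else \<infinity>)" and \<iota>_out: "\<iota> j \<notin> range \<beta>"
    if "j \<in> J" for j k
    using \<iota> that by (auto simp: X_def stiefel_matrix_def bij_betw_def)
  have le_inf: "(\<Sum>l\<in>UNIV. X l (\<sigma> l)) = \<infinity>" if "X k (\<sigma> k) = \<infinity>" for \<sigma> :: "'m \<Rightarrow> 'n" and k
    using that by (auto simp: sum_Pinfty)
  \<comment> \<open>If only \<open>\<sigma>\<close> can have finite weight, it is optimal, whether or not its own weight is finite.\<close>
  have forced: "trop_minor X A = (\<Sum>l\<in>UNIV. X l (\<sigma> l))"
    if \<sigma>: "bij_betw \<sigma> UNIV A"
      and unique: "\<And>(\<tau> :: 'm \<Rightarrow> 'n) k. bij_betw \<tau> UNIV A \<Longrightarrow> (\<And>l. X l (\<tau> l) \<noteq> \<infinity>) \<Longrightarrow> \<tau> k = \<sigma> k"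
    for A and \<sigma> :: "'m \<Rightarrow> 'n"
  proof (rule antisym)
    show "trop_minor X A \<le> (\<Sum>l\<in>UNIV. X l (\<sigma> l))"
      by (rule trop_minor_le[OF \<sigma>])
    show "(\<Sum>l\<in>UNIV. X l (\<sigma> l)) \<le> trop_minor X A"
      unfolding trop_minor_def
    proof (rule INF_greatest)
      fix \<tau> :: "'m \<Rightarrow> 'n" assume "\<tau> \<in> {\<tau>. bij_betw \<tau> UNIV A}"
      then show "(\<Sum>l\<in>UNIV. X l (\<sigma> l)) \<le> (\<Sum>l\<in>UNIV. X l (\<tau> l))"
        using unique[of \<tau>] le_inf[of _ \<tau>] by (cases "\<exists>l. X l (\<tau> l) = \<infinity>") auto
    qed
  qed
  have "trop_minor X (range \<beta>) = (\<Sum>l\<in>UNIV. X l (\<beta> l))"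
  proof (rule forced)
    fix \<tau> :: "'m \<Rightarrow> 'n" and k assume "bij_betw \<tau> UNIV (range \<beta>)" and fin: "\<And>l. X l (\<tau> l) \<noteq> \<infinity>"
    then obtain l where "\<tau> k = \<beta> l" by (metis bij_betw_imp_surj_on imageE rangeI)
    then show "\<tau> k = \<beta> k" using fin[of k] by (simp add: X\<beta> split: if_splits)
  qed (use \<beta> in \<open>simp add: bij_betw_def\<close>)
  then show "trop_minor X (range \<beta>) = 0"
    by (simp add: X\<beta>)
  fix j k assume j: "j \<in> J"
  let ?A = "insert (\<iota> j) (range \<beta> - {\<beta> k})" and ?\<sigma> = "\<beta>(k := \<iota> j)"
  have "trop_minor X ?A = (\<Sum>l\<in>UNIV. X l (?\<sigma> l))"
  proof (rule forced)
    show "bij_betw ?\<sigma> UNIV ?A"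
      using \<beta> \<iota>_out[OF j] by (auto simp: bij_betw_def inj_def) (metis rangeI)
    fix \<tau> :: "'m \<Rightarrow> 'n" and l assume \<tau>: "bij_betw \<tau> UNIV ?A" and fin: "\<And>l. X l (\<tau> l) \<noteq> \<infinity>"
    have img: "\<tau> l = \<iota> j \<or> \<tau> l = \<beta> l \<and> l \<noteq> k" for l
    proof -
      have "\<tau> l \<in> ?A" using \<tau> by (metis bij_betw_imp_surj_on rangeI)
      then show ?thesis using fin[of l] by (auto simp: X\<beta> split: if_splits)
    qed
    then have "\<tau> k = \<iota> j" by blast
    then have "\<tau> l \<noteq> \<iota> j" if "l \<noteq> k"
      using \<tau> that by (metis bij_betw_imp_inj_on injD)
    then show "\<tau> l = ?\<sigma> l"
      using img[of l] \<open>\<tau> k = \<iota> j\<close> by auto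
  qed
  also have "\<dots> = X k (\<iota> j)"
    by (subst sum.remove[of _ k]) (auto simp: X\<beta>)
  finally show "trop_minor X ?A = (if k \<in> I j then ereal (h j k) else \<infinity>)"
    using X\<iota>[OF j] by simp
qed

section \<open>Duality of the face posets\<close>

lemma face_poset_simps:
  "Field (face_poset \<F>) = \<F>" "(x, y) \<in> face_poset \<F> \<longleftrightarrow> x \<in> \<F> \<and> y \<in> \<F> \<and> x \<subseteq> y"
  by (auto simp: face_poset_def relation_of_def Field_def)

lemma poset_iso_sym:
  assumes "poset_iso r s"
  shows "poset_iso s r"
proof -
  obtain f where f: "bij_betw f (Field r) (Field s)"
      "\<forall>x\<in>Field r. \<forall>y\<in>Field r. (x, y) \<in> r \<longleftrightarrow> (f x, f y) \<in> s"
    using assms unfolding poset_iso_def by blast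
  let ?g = "inv_into (Field r) f"
  have g: "?g x \<in> Field r \<and> f (?g x) = x" if "x \<in> Field s" for x
    using f(1) that by (metis bij_betw_imp_surj_on f_inv_into_f inv_into_into)
  have "bij_betw ?g (Field s) (Field r)"
    using f(1) by (rule bij_betw_inv_into)
  moreover have "(x, y) \<in> s \<longleftrightarrow> (?g x, ?g y) \<in> r" if "x \<in> Field s" "y \<in> Field s" for x y
    using f(2) g that by metis
  ultimately show ?thesis
    unfolding poset_iso_def by blast
qed

lemma poset_iso_trans:
  assumes "poset_iso r s" "poset_iso s t"
  shows "poset_iso r t"
proof -
  obtain f g where fg: "bij_betw f (Field r) (Field s)" "bij_betw g (Field s) (Field t)"
      and "\<forall>x\<in>Field r. \<forall>y\<in>Field r. (x, y) \<in> r \<longleftrightarrow> (f x, f y) \<in> s"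
      "\<forall>x\<in>Field s. \<forall>y\<in>Field s. (x, y) \<in> s \<longleftrightarrow> (g x, g y) \<in> t"
    using assms unfolding poset_iso_def by blast
  moreover have "f x \<in> Field s" if "x \<in> Field r" for x
    using fg(1) that by (rule bij_betwE[rule_format])
  ultimately have "\<forall>x\<in>Field r. \<forall>y\<in>Field r. (x, y) \<in> r \<longleftrightarrow> ((g \<circ> f) x, (g \<circ> f) y) \<in> t"
    by simp
  then show ?thesis
    using bij_betw_trans[OF fg] unfolding poset_iso_def by blast
qed

text \<open>
  A parametrization of two families of sets that reverses inclusion identifies parameters
  with equal sets on both sides, hence it descends to an anti-isomorphism of the families.
\<close>

lemma poset_iso_face_poset_converse:
  assumes onto: "\<phi> ` V = W"
    and rev: "\<And>v v'. v \<in> V \<Longrightarrow> v' \<in> V \<Longrightarrow> f v \<subseteq> f v' \<longleftrightarrow> g (\<phi> v') \<subseteq> g (\<phi> v)"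
  shows "poset_iso (face_poset (f ` V)) ((face_poset (g ` W))\<inverse>)"
proof -
  define F where "F X = g (\<phi> (inv_into V f X))" for X
  have eq: "f v = f v' \<longleftrightarrow> g (\<phi> v) = g (\<phi> v')" if "v \<in> V" "v' \<in> V" for v v'
    using rev that by (auto simp: set_eq_subset)
  have F: "F (f v) = g (\<phi> v)" if "v \<in> V" for v
    using eq[of "inv_into V f (f v)" v] that by (simp add: F_def inv_into_into f_inv_into_f)
  have "F ` f ` V = g ` W"
    using F onto by (auto simp: image_image)
  moreover have "inj_on F (f ` V)"
    using F eq by (auto simp: inj_on_def)
  ultimately have "bij_betw F (f ` V) (g ` W)"
    by (simp add: bij_betw_def)
  moreover have "X \<subseteq> Y \<longleftrightarrow> F Y \<subseteq> F X" if XY: "X \<in> f ` V" "Y \<in> f ` V" for X Y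
  proof -
    obtain v v' where "v \<in> V" "X = f v" "v' \<in> V" "Y = f v'"
      using XY by blast
    then show ?thesis
      using rev[of v v'] F by simp
  qed
  moreover have "F X \<in> g ` W" if "X \<in> f ` V" for X
    using that \<open>F ` f ` V = g ` W\<close> by blast
  ultimately show ?thesis
    unfolding poset_iso_def Field_converse face_poset_simps
    by (intro exI[of _ F]) (auto simp: face_poset_simps)
qed

context based_valuated_matroid
begin

lemma cells_dual_to_mixed_subdivision:
  assumes "finite J"
  shows "poset_iso (face_poset (local_cells m p B)) ((face_poset (mixed_subdivision_faces J I h))\<inverse>)"
  unfolding local_cells_def mixed_subdivision_faces_def
proof (rule poset_iso_face_poset_converse[OF chart_onto])
  fix v v' assume v: "v \<in> L" "v' \<in> L"
  show "closure (stratum v) \<subseteq> closure (stratum v') \<longleftrightarrow>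
    (\<Sum>j\<in>J. simplex_face (tight v' j)) \<subseteq> (\<Sum>j\<in>J. simplex_face (tight v j))"
    unfolding cell_subset_iff[OF v] by (rule mixed_face_subset_iff[OF assms I_nonempty, symmetric])
qed

end

text \<open>
  Ensures that the summands read off from a loopless tropical linear space are nonempty.
\<close>

lemma (in valuated_matroid) neighbour_through_nonloop:
  assumes B: "B \<in> \<B>" and loopless: "loopless \<B>" and i: "i \<notin> B"
  shows "\<exists>b\<in>B. insert i (B - {b}) \<in> \<B>"
proof -
  obtain A where "A \<in> \<B>" "i \<in> A"
    using loopless by (auto simp: loopless_def)
  then show ?thesis
    using exchange[OF _ B _ i] by metis
qed

theorem theorem3p3:
  fixes P :: "'a rel"
  assumes "Partial_order P"
    and "CARD('m::finite) \<le> CARD('n::finite)"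
  shows "(\<exists>(p :: 'n set \<Rightarrow> ereal) B.
            tropical_pluecker CARD('m) p \<and> loopless (bases CARD('m) p) \<and>
            B \<in> bases CARD('m) p \<and>
            poset_iso P (face_poset (local_cells CARD('m) p B))) \<longleftrightarrow>
         (\<exists>(I :: nat \<Rightarrow> 'm set) (h :: nat \<Rightarrow> 'm \<Rightarrow> real).
            (\<forall>j\<in>{1..CARD('n) - CARD('m)}. I j \<noteq> {}) \<and>
            poset_iso P ((face_poset (mixed_subdivision_faces {1..CARD('n) - CARD('m)} I h))\<inverse>))"
    (is "?tropical \<longleftrightarrow> ?mixed")
proof
  let ?J = "{1..CARD('n) - CARD('m)}"
  assume ?tropical
  then obtain p :: "'n set \<Rightarrow> ereal" and B where p: "tropical_pluecker CARD('m) p"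
      and loopless: "loopless (bases CARD('m) p)" and B: "B \<in> bases CARD('m) p"
      and iso: "poset_iso P (face_poset (local_cells CARD('m) p B))"
    by blast
  interpret valuated_matroid "CARD('m)" p
    by standard (rule p)
  have card: "card B = CARD('m)" "card (- B) = CARD('n) - CARD('m)"
    using B by (simp_all add: bases_def Compl_eq_Diff_UNIV card_Diff_subset)
  obtain \<beta> :: "'m \<Rightarrow> 'n" where \<beta>: "bij_betw \<beta> UNIV B"
    using finite_same_card_bij[of "UNIV :: 'm set" B] card by auto
  obtain \<iota> :: "nat \<Rightarrow> 'n" where \<iota>: "bij_betw \<iota> ?J (- B)"
    using finite_same_card_bij[of ?J "- B"] card by auto
  define I where "I j = {k. insert (\<iota> j) (B - {\<beta> k}) \<in> \<B>}" for j
  define h where "h j k = val (insert (\<iota> j) (B - {\<beta> k})) - val B" for j k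
  interpret based_valuated_matroid "CARD('m)" p B \<beta> ?J \<iota> I h
  proof standard
    fix j assume j: "j \<in> ?J"
    then have "\<iota> j \<notin> B" using bij_betwE[OF \<iota>] by blast
    then show "I j \<noteq> {}"
      using neighbour_through_nonloop[OF B loopless] \<beta> by (fastforce simp: I_def bij_betw_def)
    show "p (insert (\<iota> j) (B - {\<beta> k})) = p B + ereal (h j k)" if "k \<in> I j" for k
      using that B by (simp add: I_def h_def p_basis)
  qed (fact B \<beta> \<iota> | simp add: I_def)+
  show ?mixed
    using poset_iso_trans[OF iso cells_dual_to_mixed_subdivision] I_nonempty by blast
next
  let ?J = "{1..CARD('n) - CARD('m)}"
  assume ?mixed
  then obtain I :: "nat \<Rightarrow> 'm set" and h :: "nat \<Rightarrow> 'm \<Rightarrow> real"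
    where I: "\<forall>j\<in>?J. I j \<noteq> {}"
      and iso: "poset_iso P ((face_poset (mixed_subdivision_faces ?J I h))\<inverse>)"
    by blast
  obtain \<beta> :: "'m \<Rightarrow> 'n" where \<beta>: "inj \<beta>"
    using assms(2) card_le_inj[of "UNIV :: 'm set" "UNIV :: 'n set"] by auto
  define B where "B = range \<beta>"
  have card: "card B = CARD('m)" "card (- B) = CARD('n) - CARD('m)"
    using \<beta> by (simp_all add: B_def Compl_eq_Diff_UNIV card_Diff_subset card_image)
  obtain \<iota> :: "nat \<Rightarrow> 'n" where \<iota>: "bij_betw \<iota> ?J (- B)"
    using finite_same_card_bij[of ?J "- B"] card by auto
  define p where "p = trop_minor (stiefel_matrix \<beta> ?J \<iota> I h)"
  have pB: "p B = 0"
    and p_swap: "\<And>j k. j \<in> ?J \<Longrightarrow>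
      p (insert (\<iota> j) (B - {\<beta> k})) = (if k \<in> I j then ereal (h j k) else \<infinity>)"
    using trop_minor_stiefel[OF \<beta>, where \<iota> = \<iota> and J = ?J and I = I and h = h] \<iota> by (auto simp: p_def B_def)
  have p: "tropical_pluecker CARD('m) p"
    unfolding p_def
  proof (rule tropical_pluecker_trop_minor)
    show "stiefel_matrix \<beta> ?J \<iota> I h k i \<noteq> -\<infinity>" for k i
      by (auto simp: stiefel_matrix_def Let_def)
  qed (use card pB in \<open>auto simp: p_def\<close>)
  interpret valuated_matroid "CARD('m)" p
    by standard (rule p)
  have B: "B \<in> \<B>"
    using card pB by (simp add: bases_def)
  have I_iff: "k \<in> I j \<longleftrightarrow> insert (\<iota> j) (B - {\<beta> k}) \<in> \<B>" if "j \<in> ?J" for j k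
  proof -
    have "\<iota> j \<in> - B" using bij_betwE[OF \<iota>] that by blast
    then have "\<iota> j \<notin> B" "\<beta> k \<in> B" by (auto simp: B_def)
    then show ?thesis
      using p_swap[OF that, of k] card_swap[OF card(1)] by (auto simp: bases_def)
  qed
  interpret based_valuated_matroid "CARD('m)" p B \<beta> ?J \<iota> I h
  proof standard
    show "bij_betw \<beta> UNIV B"
      using \<beta> by (simp add: B_def bij_betw_def)
    show "I j \<noteq> {}" if "j \<in> ?J" for j
      using I that by blast
    show "p (insert (\<iota> j) (B - {\<beta> k})) = p B + ereal (h j k)" if "j \<in> ?J" "k \<in> I j" for j k
      using p_swap[OF that(1)] that(2) pB by simp
  qed (fact B \<iota> I_iff)+
  have "loopless \<B>"
    unfolding loopless_def
  proof
    fix i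
    show "\<exists>A\<in>\<B>. i \<in> A"
    proof (cases "i \<in> B")
      case False
      then obtain j where j: "j \<in> ?J" "i = \<iota> j"
        using outside by blast
      then obtain k where "k \<in> I j"
        using I by blast
      then show ?thesis
        using I_iff[OF j(1)] j(2) by blast
    qed (use B in blast)
  qed
  then show ?tropical
    using p B poset_iso_trans[OF iso poset_iso_sym[OF cells_dual_to_mixed_subdivision]] by blast
qed

end
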